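(* Let $X$ be a $W$-hyperbolic space, $C\subseteq X$ a convex subset, $T:C\to C$ a nonexpansive mapping with a fixed point $p$, $u,y_0\in C$, and $(\beta_n)_{n\in\mathbb N},(\lambda_n)_{n\in\mathbb N}$ sequences in $[0,1]$. Let $(y_n)$ be the modified Halpern iteration starting with $y_0$, and let $K\ge1$ be an integer with $K\ge\max\{d(u,p),d(y_0,p)\}$. Let $\sigma_2,\sigma_3,\sigma_4:\mathbb N\to\mathbb N$ and assume that $\sum_{n=0}^\infty|\beta_{n+1}-\beta_n|$ converges with Cauchy modulus $\sigma_2$, $\sum_{n=0}^\infty|\lambda_{n+1}-\lambda_n|$ converges with Cauchy modulus $\sigma_3$, and $\lim_{n\to\infty}\beta_n=1$ with rate of convergence $\sigma_4$. Define $$\chi(k)=\max\{\sigma_2(8K(k+1)-1),\ \sigma_3(8K(k+1)-1)\},\qquad\theta(k)=\sigma_4(6K(k+1)-1).$$ (i) Suppose that $\sum_{n=2}^\infty(1-\beta_n)$ diverges with rate of divergence $\sigma_1:\mathbb N\to\mathbb N$. Then (a) $(y_n)$ is asymptotically regular with rate $$\Sigma(k)=\max\{\theta(k),\ \sigma_1(\chi(9k+8)+2+\lceil\ln(18K(k+1))\rceil)+1\}.$$ (b) If $\Lambda\in\mathbb N$, $\Lambda\ge1$, and $N_\Lambda\in\mathbb N$ are such that $\lambda_n\ge\frac1\Lambda$ for all $n\ge N_\Lambda$, then $(y_n)$ is $T$-asymptotically regular with rate $$\widehat\Sigma(k)=\max\{\theta(k),\ N_\Lambda,\ \Sigma(6\Lambda(k+1)-1),\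 \sigma_4(12K\Lambda(k+1)-1)\}.$$ (ii) Suppose that $\prod_{n=1}^\infty\beta_{n+1}=0$ with rate of convergence $\sigma_1^*:\mathbb N\to\mathbb N$ and that $\psi:\mathbb N\to\mathbb N\setminus\{0\}$ is such that $\frac1{\psi(k)}\le\prod_{n=0}^{\chi(3k+2)}\beta_{n+1}$ for all $k\in\mathbb N$. Then (a) $(y_n)$ is asymptotically regular with rate $$\Sigma^*(k)=\max\{\theta(k),\ \sigma_1^*(\psi^*(k)-1)+1,\ \chi(9k+8)+2\},$$ where $\psi^*(k)=18K(k+1)\psi(3k+2)$. (b) If $\Lambda\in\mathbb N$, $\Lambda\ge1$, and $N_\Lambda\in\mathbb N$ are such that $\lambda_n\ge\frac1\Lambda$ for all $n\ge N_\Lambda$, then $(y_n)$ is $T$-asymptotically regular with rate $$\widehat{\Sigma^*}(k)=\max\{\theta(k),\ N_\Lambda,\ \Sigma^*(6\Lambda(k+1)-1),\ \sigma_4(12K\Lambda(k+1)-1)\}.$$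
   Context: A $W$-space is a metric space $(X,d)$ with a function $W:X\times X\times[0,1]\to X$; one writes $(1-\lambda)x+\lambda y$ for $W(x,y,\lambda)$. It is a $W$-hyperbolic space if for all $x,y,z,w\in X$ and $\lambda,\tilde\lambda\in[0,1]$: (W1) $d(z,(1-\lambda)x+\lambda y)\le(1-\lambda)d(z,x)+\lambda d(z,y)$; (W2) $d((1-\lambda)x+\lambda y,(1-\tilde\lambda)x+\tilde\lambda y)=|\lambda-\tilde\lambda|\,d(x,y)$; (W3) $(1-\lambda)x+\lambda y=\lambda y+(1-\lambda)x$, i.e. $W(x,y,\lambda)=W(y,x,1-\lambda)$; (W4) $d((1-\lambda)x+\lambda z,(1-\lambda)y+\lambda w)\le(1-\lambda)d(x,y)+\lambda d(z,w)$. A nonempty $C\subseteq X$ is convex if $(1-\lambda)x+\lambda y\in C$ for all $x,y\in C$, $\lambda\in[0,1]$. $T$ is nonexpansive if $d(Tx,Ty)\le d(x,y)$ for all $x,y\in C$. Modified Halpern iteration: $y_{n+1}=(1-\beta_{n+1})u+\beta_{n+1}v_n$ with $v_n=(1-\lambda_n)y_n+\lambda_nTy_n$. Quantitative notions (all moduli are functions $\mathbb N\to\mathbb N$). Rate of convergence of $a_n\to a$: $\varphi$ with $|a_n-a|\le\frac1{k+1}$ for all $k$ and $n\ge\varphi(k)$; for the infinite product $\prod_{n=1}^\infty\beta_{n+1}=0$ this refers to the partial products $\prod_{i=1}^n\beta_{i+1}$. Cauchy modulus of a convergent series $\sum_{n=0}^\infty b_n$ with $b_n\ge0$: a function $\mu$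 with $\sum_{i=n+1}^{n+m}b_i\le\frac1{k+1}$ for all $k,m\in\mathbb N$ and $n\ge\mu(k)$. Rate of divergence of $\sum_{n=2}^\infty b_n$ with $b_n\ge0$: a function $\rho$ with $\sum_{i=2}^{\rho(k)}b_i\ge k$ for all $k$. A sequence $(a_n)$ in $C$ is asymptotically regular (resp. $T$-asymptotically regular) with rate $\varphi$ if $\varphi$ is a rate of convergence of $(d(a_n,a_{n+1}))$ (resp. of $(d(a_n,Ta_n))$) to $0$. *)

theory Defs
  imports "HOL-Analysis.Analysis"
begin

text \<open>
  \<open>W x y t\<close> is written \<open>(1 - t) x + t y\<close> informally; only \<open>x, y \<in> M\<close> and
  \<open>t \<in> {0..1}\<close> matter.
\<close>

locale W_space = Metric_space M d
  for M :: "'a set" and d :: "'a \<Rightarrow> 'a \<Rightarrow> real" +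
  fixes W :: "'a \<Rightarrow> 'a \<Rightarrow> real \<Rightarrow> 'a"
  assumes W_closed: "\<lbrakk>x \<in> M; y \<in> M; t \<in> {0..1}\<rbrakk> \<Longrightarrow> W x y t \<in> M"

locale W_hyperbolic_space = W_space M d W
  for M :: "'a set" and d :: "'a \<Rightarrow> 'a \<Rightarrow> real" and W :: "'a \<Rightarrow> 'a \<Rightarrow> real \<Rightarrow> 'a" +
  assumes W1: "\<lbrakk>x \<in> M; y \<in> M; z \<in> M; t \<in> {0..1}\<rbrakk> \<Longrightarrow>
      d z (W x y t) \<le> (1 - t) * d z x + t * d z y"
    and W2: "\<lbrakk>x \<in> M; y \<in> M; t \<in> {0..1}; s \<in> {0..1}\<rbrakk> \<Longrightarrow>
      d (W x y t) (W x y s) = \<bar>t - s\<bar> * d x y"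
    and W3: "\<lbrakk>x \<in> M; y \<in> M; t \<in> {0..1}\<rbrakk> \<Longrightarrow> W x y t = W y x (1 - t)"
    and W4: "\<lbrakk>x \<in> M; y \<in> M; z \<in> M; w \<in> M; t \<in> {0..1}\<rbrakk> \<Longrightarrow>
      d (W x z t) (W y w t) \<le> (1 - t) * d x y + t * d z w"

definition W_convex :: "('a \<Rightarrow> 'a \<Rightarrow> real \<Rightarrow> 'a) \<Rightarrow> 'a set \<Rightarrow> bool" where
  "W_convex W C \<longleftrightarrow> C \<noteq> {} \<and> (\<forall>x\<in>C. \<forall>y\<in>C. \<forall>t\<in>{0..1}. W x y t \<in> C)"

definition nonexpansive_on :: "('a \<Rightarrow> 'a \<Rightarrow> real) \<Rightarrow> 'a set \<Rightarrow> ('a \<Rightarrow> 'a) \<Rightarrow> bool" where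
  "nonexpansive_on d C T \<longleftrightarrow> (\<forall>x\<in>C. \<forall>y\<in>C. d (T x) (T y) \<le> d x y)"

primrec modified_halpern ::
  "('a \<Rightarrow> 'a \<Rightarrow> real \<Rightarrow> 'a) \<Rightarrow> ('a \<Rightarrow> 'a) \<Rightarrow> 'a \<Rightarrow> (nat \<Rightarrow> real) \<Rightarrow> (nat \<Rightarrow> real) \<Rightarrow> 'a \<Rightarrow> nat \<Rightarrow> 'a"
where
  "modified_halpern W T u \<beta> lam y0 0 = y0"
| "modified_halpern W T u \<beta> lam y0 (Suc n) =
    (let y = modified_halpern W T u \<beta> lam y0 n; v = W y (T y) (lam n)
     in W u v (\<beta> (Suc n)))"

definition rate_of_convergence :: "(nat \<Rightarrow> real) \<Rightarrow> real \<Rightarrow> (nat \<Rightarrow> nat) \<Rightarrow> bool" where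
  "rate_of_convergence a l \<phi> \<longleftrightarrow> (\<forall>k. \<forall>n\<ge>\<phi> k. \<bar>a n - l\<bar> \<le> 1 / (real k + 1))"

text \<open>
  Rate of convergence to 0 of \<open>\<Prod>i=1..n. b (i + 1)\<close>.  These partial products start at
  \<open>n = 1\<close>, so the empty product (\<open>n = 0\<close>), which equals 1, is not required to be small.
\<close>

definition product_null_rate :: "(nat \<Rightarrow> real) \<Rightarrow> (nat \<Rightarrow> nat) \<Rightarrow> bool" where
  "product_null_rate b \<phi> \<longleftrightarrow>
    (\<forall>k n. 1 \<le> n \<longrightarrow> \<phi> k \<le> n \<longrightarrow> \<bar>(\<Prod>i=1..n. b (i + 1)) - 0\<bar> \<le> 1 / (real k + 1))"

definition Cauchy_modulus :: "(nat \<Rightarrow> real) \<Rightarrow> (nat \<Rightarrow> nat) \<Rightarrow> bool" where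
  "Cauchy_modulus b \<mu> \<longleftrightarrow> (\<forall>k m. \<forall>n\<ge>\<mu> k. (\<Sum>i=n+1..n+m. b i) \<le> 1 / (real k + 1))"

definition rate_of_divergence_from_2 :: "(nat \<Rightarrow> real) \<Rightarrow> (nat \<Rightarrow> nat) \<Rightarrow> bool" where
  "rate_of_divergence_from_2 b \<rho> \<longleftrightarrow> (\<forall>k. (\<Sum>i=2..\<rho> k. b i) \<ge> real k)"

definition asymptotically_regular_with_rate ::
  "('a \<Rightarrow> 'a \<Rightarrow> real) \<Rightarrow> (nat \<Rightarrow> 'a) \<Rightarrow> (nat \<Rightarrow> nat) \<Rightarrow> bool" where
  "asymptotically_regular_with_rate d a \<phi> \<longleftrightarrow>
    rate_of_convergence (\<lambda>n. d (a n) (a (n + 1))) 0 \<phi>"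

definition T_asymptotically_regular_with_rate ::
  "('a \<Rightarrow> 'a \<Rightarrow> real) \<Rightarrow> ('a \<Rightarrow> 'a) \<Rightarrow> (nat \<Rightarrow> 'a) \<Rightarrow> (nat \<Rightarrow> nat) \<Rightarrow> bool" where
  "T_asymptotically_regular_with_rate d T a \<phi> \<longleftrightarrow>
    rate_of_convergence (\<lambda>n. d (a n) (T (a n))) 0 \<phi>"

end

theory Submission
  imports Defs
begin

text \<open>
  Put \<open>a\<^sub>n = d(y\<^sub>n, y\<^sub>n\<^sub>+\<^sub>1)\<close>. All points of the iteration stay within distance \<open>K\<close> of \<open>p\<close>, so the axioms give
  \<open>a\<^sub>n\<^sub>+\<^sub>1 \<le> \<beta>\<^sub>n\<^sub>+\<^sub>2 a\<^sub>n + 2K (\<bar>\<beta>\<^sub>n\<^sub>+\<^sub>2 - \<beta>\<^sub>n\<^sub>+\<^sub>1\<bar> + \<bar>\<lambda>\<^sub>n\<^sub>+\<^sub>1 - \<lambda>\<^sub>n\<bar>)\<close>.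
  Unrolling this from \<open>s = \<chi>(9k+8) + 1\<close> bounds \<open>a\<^sub>n\<close> by \<open>2K \<Prod>\<^sub>s\<^sub>\<le>\<^sub>i\<^sub><\<^sub>n \<beta>\<^sub>i\<^sub>+\<^sub>2\<close> plus a tail that
  is at most \<open>1/(18(k+1))\<close>.
  In (i) the product is compared with \<open>exp (- \<Sum> (1 - \<beta>\<^sub>i\<^sub>+\<^sub>2))\<close>. In (ii) it is a quotient of two partial
  products; \<open>\<psi>\<close> controls all factors of the denominator but the last, and that one is close to 1
  because a Cauchy modulus of the variation of \<open>\<beta>\<close> also bounds \<open>1 - \<beta>\<^sub>n\<close>.
  Finally \<open>\<lambda>\<^sub>n d(y\<^sub>n, T y\<^sub>n) \<le> a\<^sub>n + 2K (1 - \<beta>\<^sub>n\<^sub>+\<^sub>1)\<close> turns regularity into \<open>T\<close>-regularity.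
\<close>

section \<open>Real sequences\<close>

text \<open>Since every factor lies in \<open>{0..1}\<close>, an error already incurred never grows
  under later multiplications, so errors simply add up.\<close>

lemma linear_recursion_le:
  fixes a q c :: "nat \<Rightarrow> real"
  assumes step: "\<And>n. a (n + 1) \<le> q n * a n + c n"
    and q: "\<And>n. q n \<in> {0..1}" and c: "\<And>n. 0 \<le> c n" and "s \<le> n"
  shows "a n \<le> (\<Prod>i=s..<n. q i) * a s + (\<Sum>i=s..<n. c i)"
  using \<open>s \<le> n\<close>
proof (induction n rule: dec_induct)
  case base
  show ?case by simp
next
  case (step m)
  let ?S = "\<Sum>i=s..<m. c i"
  have "q m * a m \<le> q m * ((\<Prod>i=s..<m. q i) * a s + ?S)"
    using step.IH q[of m] by (intro mult_left_mono) auto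
  moreover have "q m * ?S \<le> ?S"
    using q[of m] c by (intro mult_left_le_one_le sum_nonneg) auto
  ultimately show ?case
    using assms(1)[of m] step.hyps by (simp add: algebra_simps)
qed

text \<open>Factorwise from \<open>1 + x \<le> exp x\<close> with
  \<open>x = f i - 1\<close>.\<close>

lemma prod_le_exp_neg_sum:
  fixes f :: "'b \<Rightarrow> real"
  assumes "\<And>i. i \<in> I \<Longrightarrow> 0 \<le> f i"
  shows "(\<Prod>i\<in>I. f i) \<le> exp (- (\<Sum>i\<in>I. 1 - f i))"
proof (cases "finite I")
  case True
  have "(\<Prod>i\<in>I. f i) \<le> (\<Prod>i\<in>I. exp (- (1 - f i)))"
  proof (rule prod_mono)
    fix i assume "i \<in> I"
    then show "0 \<le> f i \<and> f i \<le> exp (- (1 - f i))"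
      using assms exp_ge_add_one_self[of "f i - 1"] by auto
  qed
  also have "\<dots> = exp (- (\<Sum>i\<in>I. 1 - f i))"
    using True by (simp add: exp_sum[symmetric] sum_negf[symmetric])
  finally show ?thesis .
\<comment> \<open>For infinite \<open>I\<close> the product defaults to 1 and the sum to 0, so both
  sides equal 1.\<close>
qed simp

lemma sum_one_minus_le_diff:
  fixes f :: "nat \<Rightarrow> real"
  assumes "\<And>i. 0 \<le> f i" and "m \<le> n"
  shows "(\<Sum>i=m..<n. 1 - f i) \<le> real n - real m"
proof -
  have "(\<Sum>i=m..<n. 1 - f i) \<le> (\<Sum>i=m..<n. 1)"
    using assms(1) by (intro sum_mono) simp
  with assms(2) show ?thesis by simp
qed

section \<open>Moduli and rates evaluated at accuracy \<open>1 / q\<close>\<close>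

lemma Cauchy_modulusD:
  assumes "Cauchy_modulus b \<mu>" and "0 < q" and "\<mu> (q - 1) < s"
  shows "(\<Sum>i=s..<n. b i) \<le> 1 / real q"
proof (cases "s \<le> n")
  case True
  \<comment> \<open>The modulus controls sums that begin one past its threshold; hence the strict
    hypothesis and the shift to \<open>s - 1\<close>.\<close>
  have "\<mu> (q - 1) \<le> s - 1" using assms(3) by simp
  then have "(\<Sum>i=(s - 1) + 1..(s - 1) + (n - s). b i) \<le> 1 / (real (q - 1) + 1)"
    using assms(1) unfolding Cauchy_modulus_def by blast
  moreover have "{(s - 1) + 1..(s - 1) + (n - s)} = {s..<n}"
    using True assms(3) by auto
  ultimately show ?thesis
    using assms(2) by (simp add: of_nat_diff)
qed simp

lemma rate_of_convergenceD:
  assumes "rate_of_convergence a l \<phi>" and "0 < q" and "\<phi> (q - 1) \<le> n"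
  shows "\<bar>a n - l\<bar> \<le> 1 / real q"
proof -
  have "\<bar>a n - l\<bar> \<le> 1 / (real (q - 1) + 1)"
    using assms(1,3) unfolding rate_of_convergence_def by blast
  with assms(2) show ?thesis by (simp add: of_nat_diff)
qed

lemma product_null_rateD:
  assumes "product_null_rate b \<phi>" and "0 < q" and "\<phi> (q - 1) \<le> n" and "1 \<le> n"
  shows "\<bar>\<Prod>i=1..n. b (i + 1)\<bar> \<le> 1 / real q"
proof -
  have "\<bar>\<Prod>i=1..n. b (i + 1)\<bar> \<le> 1 / (real (q - 1) + 1)"
    using assms(1,3,4) unfolding product_null_rate_def by auto
  with assms(2) show ?thesis by (simp add: of_nat_diff)
qed

text \<open>Telescoping bounds \<open>\<bar>a n - a s\<bar>\<close> by the tail variation; then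
  \<open>n\<close> tends to infinity. In (ii) this gives a lower bound on \<open>\<beta>\<close> at
  an index governed by \<open>chi\<close>, where \<open>\<sigma>4\<close> may say nothing.\<close>

lemma Cauchy_modulus_variation_limit:
  fixes a :: "nat \<Rightarrow> real"
  assumes "Cauchy_modulus (\<lambda>n. \<bar>a (n + 1) - a n\<bar>) \<mu>" and "a \<longlonglongrightarrow> l"
    and "0 < q" and "\<mu> (q - 1) < s"
  shows "\<bar>l - a s\<bar> \<le> 1 / real q"
proof (rule LIMSEQ_le_const2)
  show "(\<lambda>n. \<bar>a n - a s\<bar>) \<longlonglongrightarrow> \<bar>l - a s\<bar>"
    using assms(2) by (intro tendsto_intros)
  have "\<bar>a n - a s\<bar> \<le> 1 / real q" if "s \<le> n" for n
  proof -
    have "\<bar>a n - a s\<bar> = \<bar>\<Sum>i=s..<n. a (i + 1) - a i\<bar>"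
      using sum_Suc_diff'[OF that, of a] by simp
    also have "\<dots> \<le> (\<Sum>i=s..<n. \<bar>a (i + 1) - a i\<bar>)"
      by (rule sum_abs)
    also have "\<dots> \<le> 1 / real q"
      using Cauchy_modulusD[OF assms(1,3,4)] .
    finally show ?thesis .
  qed
  then show "\<exists>N. \<forall>n\<ge>N. \<bar>a n - a s\<bar> \<le> 1 / real q" by blast
qed

section \<open>The iteration\<close>

locale bounded_modified_halpern = W_hyperbolic_space X d W
  for X :: "'a set" and d :: "'a \<Rightarrow> 'a \<Rightarrow> real" and W :: "'a \<Rightarrow> 'a \<Rightarrow> real \<Rightarrow> 'a" +
  fixes C :: "'a set" and T :: "'a \<Rightarrow> 'a" and p u y0 :: 'a and \<beta> lam :: "nat \<Rightarrow> real"
    and y :: "nat \<Rightarrow> 'a" and K :: nat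
  assumes C_sub: "C \<subseteq> X" and C_convex: "W_convex W C"
    and T_into: "T \<in> C \<rightarrow> C" and T_nonexp: "nonexpansive_on d C T"
    and p_in: "p \<in> C" and p_fix: "T p = p" and u_in: "u \<in> C" and y0_in: "y0 \<in> C"
    and \<beta>: "\<beta> n \<in> {0..1}" and lam: "lam n \<in> {0..1}"
    and y_eq: "y = modified_halpern W T u \<beta> lam y0"
    and K_ge_1: "1 \<le> K" and u_bound: "d u p \<le> K" and y0_bound: "d y0 p \<le> K"
begin

section \<open>Invariance of \<open>C\<close> and boundedness of the orbit\<close>

definition v :: "nat \<Rightarrow> 'a" where "v n = W (y n) (T (y n)) (lam n)"

lemma y_0: "y 0 = y0"
  by (simp add: y_eq)

lemma y_Suc: "y (Suc n) = W u (v n) (\<beta> (Suc n))"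
  unfolding v_def by (simp add: y_eq Let_def)

lemma in_X: "x \<in> C \<Longrightarrow> x \<in> X"
  using C_sub by blast

lemma T_in: "x \<in> C \<Longrightarrow> T x \<in> C"
  using T_into by auto

lemma W_in: "x \<in> C \<Longrightarrow> z \<in> C \<Longrightarrow> t \<in> {0..1} \<Longrightarrow> W x z t \<in> C"
  using C_convex by (auto simp: W_convex_def)

lemma y_in: "y n \<in> C"
  by (induction n) (auto simp: y_0 y_Suc v_def y0_in u_in intro!: W_in T_in \<beta> lam)

lemma v_in: "v n \<in> C"
  unfolding v_def by (intro W_in T_in y_in lam)

lemma T_bound: "x \<in> C \<Longrightarrow> d (T x) p \<le> d x p"
  using T_nonexp p_in p_fix by (metis nonexpansive_on_def)

text \<open>By (W1), closed balls around \<open>p\<close> are convex.\<close>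

lemma W_bound:
  assumes "x \<in> C" "z \<in> C" "t \<in> {0..1}" "d x p \<le> K" "d z p \<le> K"
  shows "d (W x z t) p \<le> K"
proof -
  have "d p (W x z t) \<le> (1 - t) * d p x + t * d p z"
    using assms in_X p_in by (intro W1) auto
  also have "\<dots> \<le> (1 - t) * K + t * K"
    using assms by (intro add_mono mult_left_mono) (auto simp: commute)
  finally show ?thesis
    by (simp add: commute algebra_simps)
qed

text \<open>Stated conditionally so that the induction for \<open>y_bound\<close> can use
  it.\<close>

lemma v_bound_if: "d (y n) p \<le> K \<Longrightarrow> d (v n) p \<le> K"
  unfolding v_def using T_bound[OF y_in, of n]
  by (intro W_bound y_in T_in lam) auto

lemma y_bound: "d (y n) p \<le> K"
proof (induction n)
  case 0
  then show ?case by (simp add: y_0 y0_bound)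
next
  case (Suc n)
  show ?case
    unfolding y_Suc using v_bound_if[OF Suc] u_bound by (intro W_bound u_in v_in \<beta>)
qed

lemma v_bound: "d (v n) p \<le> K"
  using v_bound_if y_bound .

lemma dist_le_2K:
  assumes "x \<in> C" "z \<in> C" "d x p \<le> K" "d z p \<le> K"
  shows "d x z \<le> 2 * K"
  using triangle[of x p z] assms in_X p_in by (auto simp: commute)

lemma dist_u_v: "d u (v n) \<le> 2 * K"
  by (intro dist_le_2K u_in v_in u_bound v_bound)

lemma dist_y_T: "d (y n) (T (y n)) \<le> 2 * K"
  using T_bound[OF y_in, of n] y_bound[of n] by (intro dist_le_2K y_in T_in) auto

lemma dist_y_Suc: "d (y n) (y (n + 1)) \<le> 2 * K"
  by (intro dist_le_2K y_in y_bound)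

section \<open>One-step estimates\<close>

text \<open>The intermediate point \<open>W x z t\<close> separates the two changes: (W2) handles
  the parameter, (W4) the end points.\<close>

lemma W_change:
  assumes "x \<in> C" "z \<in> C" "x' \<in> C" "z' \<in> C" "s \<in> {0..1}" "t \<in> {0..1}"
  shows "d (W x z s) (W x' z' t) \<le> \<bar>s - t\<bar> * d x z + ((1 - t) * d x x' + t * d z z')"
proof -
  have "d (W x z s) (W x' z' t) \<le> d (W x z s) (W x z t) + d (W x z t) (W x' z' t)"
    using assms by (intro triangle in_X W_in)
  moreover have "d (W x z s) (W x z t) = \<bar>s - t\<bar> * d x z"
    using assms in_X by (intro W2) auto
  moreover have "d (W x z t) (W x' z' t) \<le> (1 - t) * d x x' + t * d z z'"
    using assms in_X by (intro W4) auto
  ultimately show ?thesis by linarith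
qed

lemma v_step: "d (v n) (v (n + 1)) \<le> d (y n) (y (n + 1)) + 2 * K * \<bar>lam (n + 1) - lam n\<bar>"
proof -
  let ?D = "d (y n) (y (n + 1))" and ?l = "lam (n + 1)"
  have "d (v n) (v (n + 1)) \<le> \<bar>lam n - ?l\<bar> * d (y n) (T (y n)) +
      ((1 - ?l) * ?D + ?l * d (T (y n)) (T (y (n + 1))))"
    unfolding v_def by (intro W_change y_in T_in lam)
  also have "\<dots> \<le> \<bar>lam n - ?l\<bar> * (2 * K) + ((1 - ?l) * ?D + ?l * ?D)"
    using T_nonexp y_in lam[of "n + 1"] dist_y_T[of n]
    by (intro add_mono mult_left_mono) (auto simp: nonexpansive_on_def)
  finally show ?thesis by (simp add: abs_minus_commute algebra_simps)
qed

lemma y_step: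
  "d (y (n + 1)) (y (n + 1 + 1)) \<le> \<beta> (n + 2) * d (y n) (y (n + 1)) +
     2 * K * (\<bar>\<beta> (n + 2) - \<beta> (n + 1)\<bar> + \<bar>lam (n + 1) - lam n\<bar>)"
proof -
  let ?b = "\<beta> (n + 2)" and ?e = "2 * K * \<bar>lam (n + 1) - lam n\<bar>"
  have "d (y (n + 1)) (y (n + 1 + 1)) \<le> \<bar>\<beta> (n + 1) - ?b\<bar> * d u (v n) +
      ((1 - ?b) * d u u + ?b * d (v n) (v (n + 1)))"
    using W_change[OF u_in v_in[of n] u_in v_in[of "n + 1"] \<beta>[of "n + 1"] \<beta>[of "n + 2"]]
    by (simp add: y_Suc)
  also have "\<dots> = \<bar>\<beta> (n + 1) - ?b\<bar> * d u (v n) + ?b * d (v n) (v (n + 1))"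
    using u_in in_X by simp
  also have "\<dots> \<le> \<bar>\<beta> (n + 1) - ?b\<bar> * (2 * K) + ?b * (d (y n) (y (n + 1)) + ?e)"
    using \<beta>[of "n + 2"] dist_u_v[of n] v_step[of n]
    by (intro add_mono mult_left_mono) auto
  \<comment> \<open>The factor \<open>?b \<le> 1\<close> is dropped from the error only; on the
    distance it must stay, as it produces the decaying product.\<close>
  also have "\<dots> \<le> \<bar>\<beta> (n + 1) - ?b\<bar> * (2 * K) + ?b * d (y n) (y (n + 1)) + ?e"
    using \<beta>[of "n + 2"] mult_left_le_one_le[of ?e ?b] by (simp add: algebra_simps)
  finally show ?thesis by (simp add: abs_minus_commute algebra_simps)
qed

text \<open>As \<open>v n\<close> is within \<open>(1 - lam n) * d (y n) (T (y n))\<close> of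
  \<open>T (y n)\<close>, the triangle inequality leaves at least the fraction \<open>lam n\<close>
  for \<open>d (y n) (v n)\<close>. The detour through \<open>y (n + 1)\<close> costs
  \<open>(1 - \<beta> (n + 1)) * d u (v n)\<close>.\<close>

lemma lam_dist_T_le:
  "lam n * d (y n) (T (y n)) \<le> d (y n) (y (n + 1)) + 2 * K * (1 - \<beta> (n + 1))"
proof -
  have "d (T (y n)) (v n) \<le> (1 - lam n) * d (T (y n)) (y n) + lam n * d (T (y n)) (T (y n))"
    unfolding v_def using y_in T_in in_X lam by (intro W1) auto
  moreover have "d (T (y n)) (T (y n)) = 0"
    using y_in T_in in_X by simp
  moreover have "d (y n) (T (y n)) \<le> d (y n) (v n) + d (v n) (T (y n))"
    by (intro triangle in_X y_in T_in v_in)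
  ultimately have 1: "lam n * d (y n) (T (y n)) \<le> d (y n) (v n)"
    by (simp add: commute algebra_simps)
  have "d (v n) (y (n + 1)) \<le> (1 - \<beta> (n + 1)) * d (v n) u + \<beta> (n + 1) * d (v n) (v n)"
    using W1[of u "v n" "v n" "\<beta> (n + 1)"] u_in v_in in_X \<beta> by (simp add: y_Suc)
  moreover have "d (v n) (v n) = 0"
    using v_in in_X by simp
  moreover have "(1 - \<beta> (n + 1)) * d (v n) u \<le> (1 - \<beta> (n + 1)) * (2 * K)"
    using \<beta>[of "n + 1"] dist_u_v[of n] by (intro mult_left_mono) (auto simp: commute)
  ultimately have 2: "d (y (n + 1)) (v n) \<le> 2 * K * (1 - \<beta> (n + 1))"
    by (simp add: commute algebra_simps)
  have "d (y n) (v n) \<le> d (y n) (y (n + 1)) + d (y (n + 1)) (v n)"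
    by (intro triangle in_X y_in v_in)
  with 1 2 show ?thesis by linarith
qed

section \<open>Unrolling the recursion\<close>

lemma dist_y_Suc_le_prod:
  assumes \<sigma>2: "Cauchy_modulus (\<lambda>n. \<bar>\<beta> (n + 1) - \<beta> n\<bar>) \<sigma>2"
    and \<sigma>3: "Cauchy_modulus (\<lambda>n. \<bar>lam (n + 1) - lam n\<bar>) \<sigma>3"
    and "0 < q" and s: "\<sigma>2 (q - 1) < s" "\<sigma>3 (q - 1) < s" and "s \<le> n"
  shows "d (y n) (y (n + 1)) \<le> 2 * K * (\<Prod>i=s..<n. \<beta> (i + 2)) + 4 * K / q"
proof -
  let ?P = "\<Prod>i=s..<n. \<beta> (i + 2)"
  let ?c = "\<lambda>i. 2 * K * (\<bar>\<beta> (i + 2) - \<beta> (i + 1)\<bar> + \<bar>lam (i + 1) - lam i\<bar>)"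
  have "d (y n) (y (n + 1)) \<le> ?P * d (y s) (y (s + 1)) + (\<Sum>i=s..<n. ?c i)"
    using y_step \<beta> \<open>s \<le> n\<close>
    by (intro linear_recursion_le[where a = "\<lambda>n. d (y n) (y (n + 1))" and q = "\<lambda>n. \<beta> (n + 2)"]) auto
  moreover have "?P * d (y s) (y (s + 1)) \<le> ?P * (2 * K)"
    using \<beta> dist_y_Suc by (intro mult_left_mono prod_nonneg) auto
  moreover have "(\<Sum>i=s..<n. ?c i) \<le> 2 * K * (1 / q + 1 / q)"
  proof -
    have "(\<Sum>i=s..<n. \<bar>\<beta> (i + 2) - \<beta> (i + 1)\<bar>) = (\<Sum>i=s+1..<n+1. \<bar>\<beta> (i + 1) - \<beta> i\<bar>)"
      using sum.shift_bounds_nat_ivl[of "\<lambda>i. \<bar>\<beta> (i + 1) - \<beta> i\<bar>" s 1 n] by simp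
    also have "\<dots> \<le> 1 / q"
      using s by (intro Cauchy_modulusD[OF \<sigma>2 \<open>0 < q\<close>]) auto
    finally have "(\<Sum>i=s..<n. \<bar>\<beta> (i + 2) - \<beta> (i + 1)\<bar>) \<le> 1 / q" .
    then have "2 * K * (\<Sum>i=s..<n. \<bar>\<beta> (i + 2) - \<beta> (i + 1)\<bar> + \<bar>lam (i + 1) - lam i\<bar>) \<le>
        2 * K * (1 / q + 1 / q)"
      unfolding sum.distrib
      using Cauchy_modulusD[OF \<sigma>3 \<open>0 < q\<close> s(2)] by (intro mult_left_mono add_mono) auto
    then show ?thesis by (simp add: sum_distrib_left)
  qed
  ultimately show ?thesis by (simp add: algebra_simps)
qed

text \<open>Relative to \<open>1 / (k + 1)\<close>, the product contributes 2/9 and the two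
  variation tails together 1/18. The constant 9 is the one that (ii) delivers; (i) gives 18.\<close>

lemma dist_y_Suc_le:
  assumes "Cauchy_modulus (\<lambda>n. \<bar>\<beta> (n + 1) - \<beta> n\<bar>) \<sigma>2"
    and "Cauchy_modulus (\<lambda>n. \<bar>lam (n + 1) - lam n\<bar>) \<sigma>3"
    and "\<sigma>2 (72 * K * (k + 1) - 1) < s" "\<sigma>3 (72 * K * (k + 1) - 1) < s" and "s \<le> n"
    and prod: "(\<Prod>i=s..<n. \<beta> (i + 2)) \<le> 1 / (9 * real K * (real k + 1))"
  shows "d (y n) (y (n + 1)) \<le> 1 / (real k + 1)"
proof -
  have K: "0 < real K" using K_ge_1 by simp
  have "d (y n) (y (n + 1)) \<le>
      2 * K * (\<Prod>i=s..<n. \<beta> (i + 2)) + 4 * K / (72 * K * (k + 1) :: nat)"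
    using K_ge_1 by (intro dist_y_Suc_le_prod[OF assms(1,2) _ assms(3-5)]) simp
  also have "2 * K * (\<Prod>i=s..<n. \<beta> (i + 2)) \<le> 2 * K * (1 / (9 * real K * (real k + 1)))"
    using prod by (intro mult_left_mono) auto
  finally have "d (y n) (y (n + 1)) \<le>
      2 * K * (1 / (9 * real K * (real k + 1))) + 4 * K / (72 * K * (k + 1) :: nat)"
    by simp
  also have "\<dots> = 5 / 18 * (1 / (real k + 1))"
  proof -
    have "2 * a * (1 / (9 * a * b)) + 4 * a / (72 * a * b) = 5 / 18 * (1 / b)"
      if "0 < a" "0 < b" for a b :: real
      using that by (simp add: divide_simps)
    from this[OF K, of "real k + 1"] show ?thesis
      by (simp only: of_nat_mult of_nat_add of_nat_numeral of_nat_1)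
  qed
  also have "\<dots> \<le> 1 / (real k + 1)"
    by (intro mult_left_le_one_le) auto
  finally show ?thesis .
qed

section \<open>Smallness of the products in the two cases\<close>

text \<open>The terms with index 2 to \<open>s + 1\<close> take at most \<open>s\<close> of the
  divergent sum, so at least \<open>ln r\<close> remains for the indices from \<open>s + 2\<close>
  on.\<close>

lemma prod_le_of_divergence:
  assumes div: "rate_of_divergence_from_2 (\<lambda>n. 1 - \<beta> n) \<sigma>1"
    and n: "\<sigma>1 (s + 1 + nat \<lceil>ln r\<rceil>) + 1 \<le> n" and "0 < r"
  shows "s \<le> n \<and> (\<Prod>i=s..<n. \<beta> (i + 2)) \<le> 1 / r"
proof -
  let ?M = "s + 1 + nat \<lceil>ln r\<rceil>"
  have \<beta>01: "0 \<le> \<beta> i" "\<beta> i \<le> 1" for i using \<beta>[of i] by auto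
  have "real ?M \<le> (\<Sum>i=2..\<sigma>1 ?M. 1 - \<beta> i)"
    using div unfolding rate_of_divergence_from_2_def by blast
  also have "\<dots> \<le> (\<Sum>i=2..<n+2. 1 - \<beta> i)"
    using n \<beta>01 by (intro sum_mono2) auto
  finally have M: "real ?M \<le> (\<Sum>i=2..<n+2. 1 - \<beta> i)" .
  \<comment> \<open>The \<open>n\<close> terms are at most 1 each, so a sum of at least
    \<open>?M\<close> forces \<open>n\<close> past \<open>s\<close>.\<close>
  also have "\<dots> \<le> real n"
    using sum_one_minus_le_diff[of \<beta> 2 "n + 2"] \<beta>01 by simp
  finally have sn: "s \<le> n" by simp
  have "(\<Sum>i=2..<n+2. 1 - \<beta> i) = (\<Sum>i=2..<s+2. 1 - \<beta> i) + (\<Sum>i=s+2..<n+2. 1 - \<beta> i)"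
    using sn by (intro sum.atLeastLessThan_concat[symmetric]) auto
  moreover have "(\<Sum>i=2..<s+2. 1 - \<beta> i) \<le> real s"
    using sum_one_minus_le_diff[of \<beta> 2 "s + 2"] \<beta>01 by simp
  moreover have "(\<Sum>i=s+2..<n+2. 1 - \<beta> i) = (\<Sum>i=s..<n. 1 - \<beta> (i + 2))"
    by (rule sum.shift_bounds_nat_ivl)
  moreover have "ln r \<le> real (nat \<lceil>ln r\<rceil>)" by linarith
  ultimately have "ln r \<le> (\<Sum>i=s..<n. 1 - \<beta> (i + 2))"
    using M by simp
  then have "exp (- (\<Sum>i=s..<n. 1 - \<beta> (i + 2))) \<le> exp (- ln r)" by simp
  also have "\<dots> = 1 / r" using \<open>0 < r\<close> by (simp add: exp_minus inverse_eq_divide)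
  finally show ?thesis
    using sn prod_le_exp_neg_sum[of "{s..<n}" "\<lambda>i. \<beta> (i + 2)"] \<beta>01 by auto
qed

text \<open>The partial product up to \<open>n\<close> factors as
  \<open>?R * \<beta> (s + 1) * ?Q\<close>. It is at most \<open>1 / (r * m)\<close>, while
  \<open>?R \<ge> 1 / m\<close> and \<open>\<beta> (s + 1) \<ge> 1 / 2\<close>; dividing gives the
  bound, the 2 coming from the single factor between \<open>?R\<close> and
  \<open>?Q\<close>.\<close>

lemma prod_le_of_null_rate:
  assumes null: "product_null_rate \<beta> \<sigma>" and "0 < r" "0 < m"
    and n: "\<sigma> (r * m - 1) \<le> n" "s \<le> n" and "0 < s"
    and m: "1 / real m \<le> (\<Prod>i=0..<s. \<beta> (i + 1))"
    and last: "1 / 2 \<le> \<beta> (s + 1)"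
  shows "(\<Prod>i=s..<n. \<beta> (i + 2)) \<le> 2 / real r"
proof -
  let ?Q = "\<Prod>i=s..<n. \<beta> (i + 2)" and ?R = "\<Prod>i=1..<s. \<beta> (i + 1)"
  have \<beta>01: "0 \<le> \<beta> i" "\<beta> i \<le> 1" for i using \<beta>[of i] by auto
  have Q0: "0 \<le> ?Q" and R0: "0 \<le> ?R" using \<beta>01 by (simp_all add: prod_nonneg)
  \<comment> \<open>The hypothesis on \<open>m\<close> includes the factor \<open>\<beta> 1\<close>,
    which the null product lacks; it is at most 1, so removing it keeps the lower bound.\<close>
  have "(\<Prod>i=0..<s. \<beta> (i + 1)) = \<beta> 1 * ?R"
    using \<open>0 < s\<close> by (simp add: prod.atLeast_Suc_lessThan)
  also have "\<dots> \<le> ?R" using \<beta>01 R0 by (intro mult_left_le_one_le) auto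
  finally have R: "1 / m \<le> ?R" using m by linarith
  have "(\<Prod>i=1..n. \<beta> (i + 1)) = ?R * (\<Prod>i=s..<n+1. \<beta> (i + 1))"
    using \<open>0 < s\<close> \<open>s \<le> n\<close> prod.atLeastLessThan_concat[of 1 s "n + 1" "\<lambda>i. \<beta> (i + 1)"]
    by (simp add: atLeastLessThanSuc_atLeastAtMost del: prod.op_ivl_Suc)
  also have "(\<Prod>i=s..<n+1. \<beta> (i + 1)) = \<beta> (s + 1) * ?Q"
    using \<open>s \<le> n\<close> prod.shift_bounds_nat_ivl[of "\<lambda>i. \<beta> (i + 1)" s 1 n]
    by (simp add: prod.atLeast_Suc_lessThan del: prod.op_ivl_Suc)
  finally have "?R * (\<beta> (s + 1) * ?Q) \<le> 1 / (r * m)"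
    using product_null_rateD[OF null _ n(1)] assms by fastforce
  moreover have "(1 / m) * (1 / 2 * ?Q) \<le> ?R * (\<beta> (s + 1) * ?Q)"
    using R last Q0 R0 by (intro mult_mono) auto
  ultimately have "(1 / m) * (1 / 2 * ?Q) \<le> 1 / (real r * real m)" by simp
  then show ?thesis
    using \<open>0 < r\<close> \<open>0 < m\<close> by (simp add: field_simps)
qed

text \<open>In \<open>lam_dist_T_le\<close> the arguments with \<open>6 * L\<close> and
  \<open>12 * K * L\<close> make each summand at most \<open>1 / (6 * L * (k + 1))\<close>; dividing
  by \<open>lam n \<ge> 1 / L\<close> leaves \<open>1 / (3 * (k + 1))\<close>.\<close>

lemma T_asymptotic_regularity:
  assumes reg: "asymptotically_regular_with_rate d y \<phi>"
    and \<sigma>4: "rate_of_convergence \<beta> 1 \<sigma>4"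
    and "L \<ge> 1" and lamL: "\<And>n. N \<le> n \<Longrightarrow> 1 / real L \<le> lam n"
  shows "T_asymptotically_regular_with_rate d T y
    (\<lambda>k. Max {t k, N, \<phi> (6 * L * (k + 1) - 1), \<sigma>4 (12 * K * L * (k + 1) - 1)})"
  unfolding T_asymptotically_regular_with_rate_def rate_of_convergence_def
proof (intro allI impI)
  fix k n
  assume "Max {t k, N, \<phi> (6 * L * (k + 1) - 1), \<sigma>4 (12 * K * L * (k + 1) - 1)} \<le> n"
  then have n: "N \<le> n" "\<phi> (6 * L * (k + 1) - 1) \<le> n" "\<sigma>4 (12 * K * L * (k + 1) - 1) \<le> n"
    by simp_all
  let ?D = "d (y n) (T (y n))"
  have K: "0 < real K" and L: "0 < real L" using K_ge_1 \<open>L \<ge> 1\<close> by auto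
  have "\<bar>d (y n) (y (n + 1)) - 0\<bar> \<le> 1 / (6 * L * (k + 1) :: nat)"
    using n \<open>L \<ge> 1\<close>
    by (intro rate_of_convergenceD[OF reg[unfolded asymptotically_regular_with_rate_def]]) auto
  moreover have "\<bar>\<beta> (n + 1) - 1\<bar> \<le> 1 / (12 * K * L * (k + 1) :: nat)"
    using n \<open>L \<ge> 1\<close> K_ge_1 by (intro rate_of_convergenceD[OF \<sigma>4]) auto
  then have "2 * K * (1 - \<beta> (n + 1)) \<le> 2 * K * (1 / (12 * K * L * (k + 1) :: nat))"
    by (intro mult_left_mono) auto
  moreover have "1 / L * ?D \<le> lam n * ?D"
    using lamL n by (intro mult_right_mono) auto
  ultimately have "1 / L * ?D \<le> 1 / (6 * L * (k + 1) :: nat) + 2 * K * (1 / (12 * K * L * (k + 1) :: nat))"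
    using lam_dist_T_le[of n] by linarith
  also have "\<dots> = 1 / L * (1 / (3 * (real k + 1)))"
  proof -
    have "1 / (6 * b * c) + 2 * a * (1 / (12 * a * b * c)) = 1 / b * (1 / (3 * c))"
      if "0 < a" "0 < b" "0 < c" for a b c :: real
      using that by (simp add: divide_simps)
    from this[OF K L, of "real k + 1"] show ?thesis
      by (simp only: of_nat_mult of_nat_add of_nat_numeral of_nat_1)
  qed
  finally have "?D \<le> 1 / (3 * (real k + 1))"
    using L by (simp only: mult_le_cancel_left_pos zero_less_divide_1_iff)
  also have "\<dots> \<le> 1 / (real k + 1)" by (simp add: field_simps)
  finally show "\<bar>?D - 0\<bar> \<le> 1 / (real k + 1)" by simp
qed

end

section \<open>Assembly of the rates\<close>

theorem proposition4p9:
  fixes X :: "'a set" and d :: "'a \<Rightarrow> 'a \<Rightarrow> real" and W :: "'a \<Rightarrow> 'a \<Rightarrow> real \<Rightarrow> 'a"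
    and C :: "'a set" and T :: "'a \<Rightarrow> 'a" and p u y0 :: 'a
    and \<beta> lam :: "nat \<Rightarrow> real" and y :: "nat \<Rightarrow> 'a" and K :: nat
    and \<sigma>2 \<sigma>3 \<sigma>4 chi theta :: "nat \<Rightarrow> nat"
  assumes "W_hyperbolic_space X d W"
    and "C \<subseteq> X" and "W_convex W C"
    and "T \<in> C \<rightarrow> C" and "nonexpansive_on d C T"
    and "p \<in> C" and "T p = p"
    and "u \<in> C" and "y0 \<in> C"
    and "\<And>n. \<beta> n \<in> {0..1}" and "\<And>n. lam n \<in> {0..1}"
    and y_def: "y = modified_halpern W T u \<beta> lam y0"
    and "K \<ge> 1" and "real K \<ge> max (d u p) (d y0 p)"
    and "summable (\<lambda>n. \<bar>\<beta> (n + 1) - \<beta> n\<bar>)"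
    and "Cauchy_modulus (\<lambda>n. \<bar>\<beta> (n + 1) - \<beta> n\<bar>) \<sigma>2"
    and "summable (\<lambda>n. \<bar>lam (n + 1) - lam n\<bar>)"
    and "Cauchy_modulus (\<lambda>n. \<bar>lam (n + 1) - lam n\<bar>) \<sigma>3"
    and "\<beta> \<longlonglongrightarrow> 1" and "rate_of_convergence \<beta> 1 \<sigma>4"
    and chi_def: "\<And>k. chi k = max (\<sigma>2 (8 * K * (k + 1) - 1)) (\<sigma>3 (8 * K * (k + 1) - 1))"
    and theta_def: "\<And>k. theta k = \<sigma>4 (6 * K * (k + 1) - 1)"
  shows
    "(\<forall>\<sigma>1 :: nat \<Rightarrow> nat.
        filterlim (\<lambda>n. \<Sum>i=2..n. (1 - \<beta> i)) at_top sequentially \<longrightarrow>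
        rate_of_divergence_from_2 (\<lambda>n. 1 - \<beta> n) \<sigma>1 \<longrightarrow>
        (let Sig = (\<lambda>k. max (theta k)
               (\<sigma>1 (chi (9 * k + 8) + 2 + nat \<lceil>ln (18 * real K * (real k + 1))\<rceil>) + 1))
         in asymptotically_regular_with_rate d y Sig \<and>
            (\<forall>(L::nat) (N::nat). L \<ge> 1 \<longrightarrow> (\<forall>n\<ge>N. lam n \<ge> 1 / real L) \<longrightarrow>
               T_asymptotically_regular_with_rate d T y
                 (\<lambda>k. Max {theta k, N, Sig (6 * L * (k + 1) - 1), \<sigma>4 (12 * K * L * (k + 1) - 1)}))))
     \<and>
     (\<forall>(\<sigma>1s :: nat \<Rightarrow> nat) (\<psi> :: nat \<Rightarrow> nat).
        (\<lambda>n. \<Prod>i=1..n. \<beta> (i + 1)) \<longlonglongrightarrow> 0 \<longrightarrow>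
        product_null_rate \<beta> \<sigma>1s \<longrightarrow>
        (\<forall>k. \<psi> k \<noteq> 0) \<longrightarrow>
        (\<forall>k. 1 / real (\<psi> k) \<le> (\<Prod>n=0..chi (3 * k + 2). \<beta> (n + 1))) \<longrightarrow>
        (let \<psi>s = (\<lambda>k. 18 * K * (k + 1) * \<psi> (3 * k + 2));
             Sigs = (\<lambda>k. Max {theta k, \<sigma>1s (\<psi>s k - 1) + 1, chi (9 * k + 8) + 2})
         in asymptotically_regular_with_rate d y Sigs \<and>
            (\<forall>(L::nat) (N::nat). L \<ge> 1 \<longrightarrow> (\<forall>n\<ge>N. lam n \<ge> 1 / real L) \<longrightarrow>
               T_asymptotically_regular_with_rate d T y
                 (\<lambda>k. Max {theta k, N, Sigs (6 * L * (k + 1) - 1), \<sigma>4 (12 * K * L * (k + 1) - 1)}))))"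
proof -
  interpret bounded_modified_halpern X d W C T p u y0 \<beta> lam y K
    using assms by (intro bounded_modified_halpern.intro bounded_modified_halpern_axioms.intro) auto
  note \<sigma>2 = \<open>Cauchy_modulus (\<lambda>n. \<bar>\<beta> (n + 1) - \<beta> n\<bar>) \<sigma>2\<close>
  note \<sigma>3 = \<open>Cauchy_modulus (\<lambda>n. \<bar>lam (n + 1) - lam n\<bar>) \<sigma>3\<close>
  note \<sigma>4 = \<open>rate_of_convergence \<beta> 1 \<sigma>4\<close>
  \<comment> \<open>This is \<open>8 * K * (m + 1)\<close> at \<open>m = 9 * k + 8\<close>, so
    \<open>chi (9 * k + 8)\<close> evaluates both moduli at accuracy \<open>1 / q k\<close>.\<close>
  define q where "q k = 72 * K * (k + 1)" for k
  have q: "8 * K * (9 * k + 8 + 1) - 1 = q k - 1" "0 < q k" for k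
    using K_ge_1 by (auto simp: q_def algebra_simps)
  have q_ge_2: "2 \<le> q k" for k
    using mult_le_mono[of 1 K 2 "72 * (k + 1)"] K_ge_1 by (simp add: q_def algebra_simps)
  have chi: "\<sigma>2 (q k - 1) \<le> chi (9 * k + 8)" "\<sigma>3 (q k - 1) \<le> chi (9 * k + 8)" for k
    unfolding chi_def q(1) by auto
  \<comment> \<open>Common criterion for both cases: \<open>chi (9 * k + 8) + 1\<close> lies
    strictly above both moduli, which leaves only the product to be estimated.\<close>
  have regI: "asymptotically_regular_with_rate d y \<phi>"
    if "\<And>k n. \<phi> k \<le> n \<Longrightarrow> chi (9 * k + 8) + 1 \<le> n \<and>
      (\<Prod>i=chi (9 * k + 8) + 1..<n. \<beta> (i + 2)) \<le> 1 / (9 * real K * (real k + 1))" for \<phi>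
    unfolding asymptotically_regular_with_rate_def rate_of_convergence_def
  proof (intro allI impI)
    fix k n assume "\<phi> k \<le> n"
    note prod = that[OF this]
    have "d (y n) (y (n + 1)) \<le> 1 / (real k + 1)"
    proof (rule dist_y_Suc_le[OF \<sigma>2 \<sigma>3, folded q_def])
      show "\<sigma>2 (q k - 1) < chi (9 * k + 8) + 1" "\<sigma>3 (q k - 1) < chi (9 * k + 8) + 1"
        using chi[of k] by simp_all
    qed (use prod in blast)+
    then show "\<bar>d (y n) (y (n + 1)) - 0\<bar> \<le> 1 / (real k + 1)" by simp
  qed
  show ?thesis
    unfolding Let_def
  proof (intro conjI allI impI)
    fix \<sigma>1 assume div: "rate_of_divergence_from_2 (\<lambda>n. 1 - \<beta> n) \<sigma>1"
    let ?Sig = "\<lambda>k. max (theta k)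
      (\<sigma>1 (chi (9 * k + 8) + 2 + nat \<lceil>ln (18 * real K * (real k + 1))\<rceil>) + 1)"
    show reg: "asymptotically_regular_with_rate d y ?Sig"
    proof (rule regI)
      fix k n assume n: "?Sig k \<le> n"
      let ?r = "18 * real K * (real k + 1)"
      have r: "0 < ?r" using K_ge_1 by simp
      \<comment> \<open>With \<open>s = chi (9 * k + 8) + 1\<close>, the \<open>+ 2\<close> in the
        rate is the \<open>s + 1\<close> of the divergence lemma.\<close>
      have "chi (9 * k + 8) + 1 \<le> n \<and> (\<Prod>i=chi (9 * k + 8) + 1..<n. \<beta> (i + 2)) \<le> 1 / ?r"
        using n by (intro prod_le_of_divergence[OF div _ r]) (simp add: add.assoc)
      moreover have "1 / ?r \<le> 1 / (9 * real K * (real k + 1))"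
        using K_ge_1 by (intro divide_left_mono mult_right_mono) auto
      ultimately show "chi (9 * k + 8) + 1 \<le> n \<and>
          (\<Prod>i=chi (9 * k + 8) + 1..<n. \<beta> (i + 2)) \<le> 1 / (9 * real K * (real k + 1))"
        by linarith
    qed
    fix L N :: nat assume "L \<ge> 1" "\<forall>n\<ge>N. lam n \<ge> 1 / real L"
    then show "T_asymptotically_regular_with_rate d T y
        (\<lambda>k. Max {theta k, N, ?Sig (6 * L * (k + 1) - 1), \<sigma>4 (12 * K * L * (k + 1) - 1)})"
      by (intro T_asymptotic_regularity[OF reg \<sigma>4]) blast+
  next
    fix \<sigma>1s \<psi> :: "nat \<Rightarrow> nat"
    assume null: "product_null_rate \<beta> \<sigma>1s" and \<psi>0: "\<forall>k. \<psi> k \<noteq> 0"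
      and \<psi>: "\<forall>k. 1 / real (\<psi> k) \<le> (\<Prod>n=0..chi (3 * k + 2). \<beta> (n + 1))"
    let ?Sigs = "\<lambda>k. Max {theta k, \<sigma>1s (18 * K * (k + 1) * \<psi> (3 * k + 2) - 1) + 1,
      chi (9 * k + 8) + 2}"
    show reg: "asymptotically_regular_with_rate d y ?Sigs"
    proof (rule regI)
      fix k n assume n: "?Sigs k \<le> n"
      let ?s = "chi (9 * k + 8) + 1"
      have n': "\<sigma>1s (18 * K * (k + 1) * \<psi> (3 * k + 2) - 1) \<le> n" "?s \<le> n"
        using n by (simp_all del: max_Suc_Suc)
      \<comment> \<open>Hence \<open>\<psi> (3 * k + 2)\<close> speaks about the product up to
        \<open>chi (9 * k + 8)\<close>, that is, over all indices below \<open>?s\<close>.\<close>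
      have idx: "3 * (3 * k + 2) + 2 = 9 * k + 8" by simp
      have \<psi>k: "1 / real (\<psi> (3 * k + 2)) \<le> (\<Prod>i=0..<?s. \<beta> (i + 1))"
        using \<psi>[rule_format, of "3 * k + 2", unfolded idx]
        by (simp add: atLeastLessThanSuc_atLeastAtMost del: prod.op_ivl_Suc)
      have "\<bar>1 - \<beta> (?s + 1)\<bar> \<le> 1 / real (q k)"
        using chi[of k] by (intro Cauchy_modulus_variation_limit[OF \<sigma>2 \<open>\<beta> \<longlonglongrightarrow> 1\<close> q(2)]) auto
      also have "\<dots> \<le> 1 / 2"
        using q_ge_2[of k] by (intro divide_left_mono) auto
      finally have "1 / 2 \<le> \<beta> (?s + 1)" by linarith
      \<comment> \<open>Here \<open>r = 18 * K * (k + 1)\<close> and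
        \<open>m = \<psi> (3 * k + 2)\<close>, so \<open>r * m\<close> is the
        \<open>\<psi>s k\<close> of the statement.\<close>
      then have "(\<Prod>i=?s..<n. \<beta> (i + 2)) \<le> 2 / real (18 * K * (k + 1))"
        using \<psi>0 K_ge_1 by (intro prod_le_of_null_rate[OF null _ _ n' _ \<psi>k]) auto
      also have "\<dots> = 1 / (9 * real K * (real k + 1))"
      proof -
        have "real (18 * K * (k + 1)) = 2 * (9 * real K * (real k + 1))"
          by (simp add: algebra_simps)
        moreover have "2 / (2 * x) = 1 / x" for x :: real by simp
        ultimately show ?thesis by (simp only:)
      qed
      finally show "?s \<le> n \<and> (\<Prod>i=?s..<n. \<beta> (i + 2)) \<le> 1 / (9 * real K * (real k + 1))"
        using n' by blast
    qed
    fix L N :: nat assume "L \<ge> 1" "\<forall>n\<ge>N. lam n \<ge> 1 / real L"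
    then show "T_asymptotically_regular_with_rate d T y
        (\<lambda>k. Max {theta k, N, ?Sigs (6 * L * (k + 1) - 1), \<sigma>4 (12 * K * L * (k + 1) - 1)})"
      by (intro T_asymptotic_regularity[OF reg \<sigma>4]) blast+
  qed
qed

end
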